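(* Let $n\ge4$ be an even integer, let $N=2^n$, let $F\colon\mathbb F_2^n\to\mathbb F_2^n$ be an APN function, and let $q=|\{b\in\mathbb F_2^n\setminus\{0\}: b\cdot F\text{ is not plateaued}\}|$. Then \[ q\le\frac{3N}{16}+2\quad\Longrightarrow\quad\mathcal L(F)\le\frac N2 . \]
   Context: A function $F\colon\mathbb F_2^n\to\mathbb F_2^n$ is almost perfect nonlinear (APN) if for every $h\in\mathbb F_2^n\setminus\{0\}$ and every $y\in\mathbb F_2^n$ the equation $F(x+h)+F(x)=y$ has at most two solutions $x\in\mathbb F_2^n$. For $b\in\mathbb F_2^n$ let $f_b=b\cdot F\colon\mathbb F_2^n\to\mathbb F_2$, where $\cdot$ is the usual dot product over $\mathbb F_2$. For a Boolean function $f\colon\mathbb F_2^n\to\mathbb F_2$ the Walsh transform is $W_f(a)=\sum_{x\in\mathbb F_2^n}(-1)^{f(x)+a\cdot x}$ for $a\in\mathbb F_2^n$. The linearity of $F$ is $\mathcal L(F)=\max\{|W_{f_b}(a)| : a\in\mathbb F_2^n,\ b\in\mathbb F_2^n\setminus\{0\}\}$. A Boolean function $f$ is plateaued if there is $\lambda>0$ such that $W_f(a)\in\{0,\lambda,-\lambda\}$ for all $a\in\mathbb F_2^n$ (affine Boolean functions are included). *)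

theory Defs
  imports "HOL-Analysis.Finite_Cartesian_Product" "HOL-Library.Z2"
begin

text \<open>
  The space $\mathbb{F}_2^n$ is \<^typ>\<open>bit ^ 'n\<close> with $n$ the cardinality of the index type, and the
  dot product over $\mathbb{F}_2$ is the library constant \<^const>\<open>scalar_product\<close>.
\<close>

instance bit :: finite
proof
  have "(UNIV :: bit set) \<subseteq> {0, 1}"
    by auto
  then show "finite (UNIV :: bit set)"
    by (rule finite_subset) simp
qed

definition APN :: "(bit ^ 'n \<Rightarrow> bit ^ 'n) \<Rightarrow> bool" where
  "APN F \<longleftrightarrow> (\<forall>h y. h \<noteq> 0 \<longrightarrow> card {x. F (x + h) + F x = y} \<le> 2)"

definition component :: "(bit ^ 'n \<Rightarrow> bit ^ 'n) \<Rightarrow> bit ^ 'n \<Rightarrow> bit ^ 'n \<Rightarrow> bit" where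
  "component F b = (\<lambda>x. scalar_product b (F x))"

definition walsh :: "(bit ^ 'n \<Rightarrow> bit) \<Rightarrow> bit ^ 'n \<Rightarrow> int" where
  "walsh f a = (\<Sum>x\<in>UNIV. (- 1) ^ of_bit (f x + scalar_product a x))"

definition linearity :: "(bit ^ 'n \<Rightarrow> bit ^ 'n) \<Rightarrow> int" where
  "linearity F = Max {\<bar>walsh (component F b) a\<bar> | a b. b \<noteq> 0}"

definition plateaued :: "(bit ^ 'n \<Rightarrow> bit) \<Rightarrow> bool" where
  "plateaued f \<longleftrightarrow>
    (\<exists>l::real. l > 0 \<and> (\<forall>a. real_of_int (walsh f a) \<in> {0, l, - l}))"

end

theory Submission
  imports Defs "HOL-Computational_Algebra.Primes"
begin

text \<open>
  Suppose $|W_{f_b}(a_0)| > N/2$ for some $b \neq 0$, and let $S$ be the set of points where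
  $(-1)^{f_b(x) + a_0 \cdot x}$ takes its less frequent sign $-\varepsilon$. Then $s = |S| < N/4$, and
  the idea is to look at the graph of $F$ over $S$ only, through the transform
  $\widehat S_c(a) = \sum_{x \in S} (-1)^{c \cdot F(x) + a \cdot x}$. Three facts about the fourth
  moments $M_c = \sum_a \widehat S_c(a)^4$ contradict each other when few components are not plateaued.

  From above, the graph of an APN function is a Sidon set, so
  $\sum_c M_c \le N^2 (3 s^2 - 2 s)$ (\<open>walsh_on_fourth_moment_le\<close>). From below, Parseval and the
  Cauchy--Schwarz inequality give $M_c \ge N s^2$ for every $c$, while $M_0$ and $M_b$ are at least
  $s^4$. Finally, $\widehat S_c$ is half the difference of Walsh transforms of $f_c$ and
  $f_{b+c}$ (\<open>walsh_diff_minority\<close>). If both are plateaued, then $n$ being even forces their values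
  to be multiples of $\sqrt N$ and, because $s < N/4$, so are the values of $\widehat S_c$
  (\<open>minority_walsh_on_dvd\<close>); a multiple of $\sqrt N$ satisfies $t^4 \ge N t^2$, which improves the lower
  bound to $M_c \ge N^2 s$. Comparing the bounds, more than $3N/8 + 2$ of the $c \notin \{0, b\}$ must have
  a partner pair $\{c, b + c\}$ that is not entirely plateaued (\<open>bad_count_arith\<close>). Every
  $c \notin \{0, b\}$ with $f_c$ not plateaued accounts for at most two of these, and $f_b$ itself is not
  plateaued, whence $q > 3N/16 + 2$ (\<open>many_nonplateaued\<close>).

  The comparison divides by $s$, and so the case of affine $f_b$ is separate
  (\<open>no_affine_component\<close>): there the fourth-moment bound for the whole space is attained with equality,
  all $f_c$ with $c \notin \{0, b\}$ are bent, and a parity argument as in Nyberg's bound for vectorial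
  bent functions excludes this for $n \ge 4$.
\<close>

section \<open>Characters of the space of bit vectors\<close>

definition chi :: "bit \<Rightarrow> int" where
  "chi t = (- 1) ^ of_bit t"

lemma chi_0 [simp]: "chi 0 = 1" and chi_1 [simp]: "chi 1 = -1"
  by (simp_all add: chi_def)

lemma chi_cases: "chi t = 1 \<or> chi t = -1"
  by (cases t) auto

lemma chi_square [simp]: "chi t * chi t = 1"
  by (cases t) auto

lemma chi_add: "chi (s + t) = chi s * chi t"
  by (cases s; cases t) auto

lemma vec_bit_add_self [simp]: "(v :: bit ^ 'n) + v = 0"
proof -
  have "t + t = 0" for t :: bit
    by (cases t) auto
  then show ?thesis
    by (simp only: vec_eq_iff vector_add_component zero_index simp_thms)
qed

lemma vec_bit_add_eq_0_iff: "v + w = 0 \<longleftrightarrow> v = (w :: bit ^ 'n)"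
  by (metis add_right_cancel vec_bit_add_self)

lemma vec_bit_add_add_self [simp]: "v + w + w = (v :: bit ^ 'n)"
  by (simp add: add.assoc)

lemma scalar_product_add_left: "scalar_product (u + v) w = scalar_product u w + scalar_product v w"
  for u v w :: "bit ^ 'n"
  unfolding scalar_product_def
  by (simp only: vector_add_component distrib_right sum.distrib)

lemma scalar_product_add_right: "scalar_product w (u + v) = scalar_product w u + scalar_product w v"
  for u v w :: "bit ^ 'n"
  unfolding scalar_product_def
  by (simp only: vector_add_component distrib_left sum.distrib)

lemma scalar_product_axis: "scalar_product v (axis i 1) = v $ i"
  and scalar_product_axis': "scalar_product (axis i 1) v = v $ i" for v :: "bit ^ 'n"
proof -
  have "v $ j * axis i 1 $ j = (if j = i then v $ i else 0)"
       "axis i 1 $ j * v $ j = (if j = i then v $ i else 0)" for j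
    by (auto simp: axis_def)
  then show "scalar_product v (axis i 1) = v $ i" "scalar_product (axis i 1) v = v $ i"
    unfolding scalar_product_def by (simp_all only: sum.delta finite_UNIV if_True UNIV_I finite)
qed

lemma scalar_product_0 [simp]: "scalar_product (0 :: bit ^ 'n) v = 0" "scalar_product v (0 :: bit ^ 'n) = 0"
  by (simp_all add: scalar_product_def)

lemma sum_translate: "(\<Sum>a\<in>UNIV. g (a + h)) = (\<Sum>a\<in>UNIV. g (a :: bit ^ 'n))"
  by (rule sum.reindex_bij_witness[of _ "\<lambda>a. a + h" "\<lambda>a. a + h"]) auto

lemma card_vec_bit: "CARD(bit ^ 'n) = 2 ^ CARD('n)"
proof -
  have "(UNIV :: bit set) = {0, 1}"
    by (auto intro: bit.exhaust)
  then have "CARD(bit) = 2"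
    by (metis card_2_iff zero_neq_one)
  then show ?thesis
    by simp
qed

lemma sum_chi: "(\<Sum>a\<in>UNIV. chi (scalar_product a x)) = of_bool (x = 0) * 2 ^ CARD('n)"
  for x :: "bit ^ 'n"
proof (cases "x = 0")
  case True
  then show ?thesis
    using card_vec_bit[where 'n = 'n] by simp
next
  case False
  then obtain i where i: "x $ i = 1"
    by (metis bit_not_zero_iff vec_eq_iff zero_index)
  have "(\<Sum>a\<in>UNIV. chi (scalar_product a x)) = (\<Sum>a\<in>UNIV. chi (scalar_product (a + axis i 1) x))"
    by (rule sum_translate[symmetric])
  also have "\<dots> = - (\<Sum>a\<in>UNIV. chi (scalar_product a x))"
    by (simp only: scalar_product_add_left chi_add scalar_product_axis' i chi_1
        mult_minus1_right sum_negf)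
  finally show ?thesis
    using False by simp
qed

section \<open>Walsh transforms over a subset and their moments\<close>

definition walsh_on :: "(bit ^ 'n \<Rightarrow> bit ^ 'n) \<Rightarrow> (bit ^ 'n) set \<Rightarrow> bit ^ 'n \<Rightarrow> bit ^ 'n \<Rightarrow> int" where
  "walsh_on F A c a = (\<Sum>x\<in>A. chi (scalar_product c (F x)) * chi (scalar_product a x))"

lemma walsh_component: "walsh (component F c) a = walsh_on F UNIV c a"
  unfolding walsh_def walsh_on_def component_def chi_add[symmetric] unfolding chi_def ..

lemma walsh_chi: "walsh f a = (\<Sum>x\<in>UNIV. chi (f x) * chi (scalar_product a x))"
  unfolding walsh_def chi_add[symmetric] unfolding chi_def ..

lemma twisted_parseval:
  fixes A :: "(bit ^ 'n) set"
  assumes e: "\<And>x. e x * e x = (1::int)"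
  shows "(\<Sum>a\<in>UNIV. (\<Sum>x\<in>A. e x * chi (scalar_product a x))\<^sup>2) = 2 ^ CARD('n) * int (card A)"
proof -
  have "(\<Sum>a\<in>UNIV. (\<Sum>x\<in>A. e x * chi (scalar_product a x))\<^sup>2)
      = (\<Sum>a\<in>UNIV. \<Sum>x\<in>A. \<Sum>y\<in>A. e x * e y * chi (scalar_product a (x + y)))"
    by (simp only: power2_eq_square sum_product scalar_product_add_right chi_add ac_simps)
  also have "\<dots> = (\<Sum>x\<in>A. \<Sum>y\<in>A. \<Sum>a\<in>UNIV. e x * e y * chi (scalar_product a (x + y)))"
    by (subst sum.swap) (rule sum.cong[OF refl], rule sum.swap)
  also have "\<dots> = (\<Sum>x\<in>A. \<Sum>y\<in>A. if x = y then e x * e y * 2 ^ CARD('n) else 0)"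
    by (rule sum.cong[OF refl], rule sum.cong[OF refl])
      (auto simp: sum_distrib_left[symmetric] sum_chi vec_bit_add_eq_0_iff)
  also have "\<dots> = (\<Sum>x\<in>A. 2 ^ CARD('n))"
    by (simp add: e)
  finally show ?thesis
    by simp
qed

lemma walsh_on_parseval:
  "(\<Sum>a\<in>UNIV. (walsh_on F A c a)\<^sup>2) = 2 ^ CARD('n) * int (card A)" for A :: "(bit ^ 'n) set"
  unfolding walsh_on_def by (rule twisted_parseval) simp

lemma walsh_parseval: "(\<Sum>a\<in>UNIV. (walsh f a)\<^sup>2) = (2 ^ CARD('n))\<^sup>2" for f :: "bit ^ 'n \<Rightarrow> bit"
  unfolding walsh_chi by (subst twisted_parseval) (simp_all add: card_vec_bit power2_eq_square del: CARD_vec)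

definition quadruples :: "(bit ^ 'n \<Rightarrow> bit ^ 'n) \<Rightarrow> (bit ^ 'n) set
    \<Rightarrow> (((bit ^ 'n) \<times> (bit ^ 'n)) \<times> ((bit ^ 'n) \<times> (bit ^ 'n))) set" where
  "quadruples F A = {((x, y), (z, w)) \<in> (A \<times> A) \<times> (A \<times> A).
     x + y + (z + w) = 0 \<and> F x + F y + (F z + F w) = 0}"

text \<open>
  Expanding the fourth power and summing over both frequencies, orthogonality of characters keeps exactly
  the quadruples whose sum vanishes in both the domain and the range.
\<close>

lemma walsh_on_fourth_moment:
  fixes A :: "(bit ^ 'n) set"
  shows "(\<Sum>c\<in>UNIV. \<Sum>a\<in>UNIV. (walsh_on F A c a) ^ 4)
     = (2 ^ CARD('n))\<^sup>2 * int (card (quadruples F A))"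
proof -
  define P where "P = (A \<times> A) \<times> (A \<times> A)"
  define s where "s = (\<lambda>((x, y), (z, w)). x + y + (z + w :: bit ^ 'n))"
  define S where "S = (\<lambda>((x, y), (z, w)). F x + F y + (F z + F w))"
  have sq: "(walsh_on F A c a)\<^sup>2 = (\<Sum>(x, y)\<in>A \<times> A. chi (scalar_product c (F x + F y)) * chi (scalar_product a (x + y)))"
    for c a
    by (simp only: power2_eq_square walsh_on_def sum_product scalar_product_add_right chi_add ac_simps
        sum.cartesian_product)
  have "(walsh_on F A c a) ^ 4 = (walsh_on F A c a)\<^sup>2 * (walsh_on F A c a)\<^sup>2" for c a
    by (simp add: power4_eq_xxxx power2_eq_square)
  then have four: "(walsh_on F A c a) ^ 4 = (\<Sum>p\<in>P. chi (scalar_product c (S p)) * chi (scalar_product a (s p)))"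
    for c a
    unfolding sq sum_product P_def sum.cartesian_product
    by (simp only: case_prod_unfold s_def S_def scalar_product_add_right chi_add ac_simps)
  have "(\<Sum>c\<in>UNIV. \<Sum>a\<in>UNIV. (walsh_on F A c a) ^ 4)
     = (\<Sum>c\<in>UNIV. \<Sum>p\<in>P. \<Sum>a\<in>UNIV. chi (scalar_product c (S p)) * chi (scalar_product a (s p)))"
    unfolding four by (intro sum.cong refl, rule sum.swap)
  also have "\<dots> = (\<Sum>p\<in>P. \<Sum>c\<in>UNIV. \<Sum>a\<in>UNIV. chi (scalar_product c (S p)) * chi (scalar_product a (s p)))"
    by (rule sum.swap)
  also have "\<dots> = (\<Sum>p\<in>P. (\<Sum>c\<in>UNIV. chi (scalar_product c (S p))) * (\<Sum>a\<in>UNIV. chi (scalar_product a (s p))))"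
    by (simp only: sum_product)
  also have "\<dots> = (\<Sum>p\<in>P. if s p = 0 \<and> S p = 0 then (2 ^ CARD('n))\<^sup>2 else 0)"
    by (intro sum.cong refl) (auto simp: sum_chi power2_eq_square)
  also have "\<dots> = (\<Sum>p\<in>{p \<in> P. s p = 0 \<and> S p = 0}. (2 ^ CARD('n))\<^sup>2)"
    by (rule sum.inter_filter[symmetric]) (simp add: P_def)
  also have "{p \<in> P. s p = 0 \<and> S p = 0} = quadruples F A"
    by (auto simp: quadruples_def P_def s_def S_def)
  finally show ?thesis
    by simp
qed

text \<open>
  With $h = x + y = z + w$, all of $x$, $y$, $z$ solve $F(t + h) + F(t) = F(x) + F(y)$, which has at most
  two solutions: the graph of an APN function is a Sidon set.
\<close>

lemma APN_sidon:
  assumes "APN F" and "x + y + (z + w) = 0" and "F x + F y + (F z + F w) = 0"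
  shows "x = y \<and> z = w \<or> x = z \<and> y = w \<or> x = w \<and> y = z"
proof (cases "x = y")
  case True
  then show ?thesis
    using assms(2) by (simp add: vec_bit_add_eq_0_iff)
next
  case False
  define h where "h = x + y"
  have h: "h \<noteq> 0"
    using False by (simp add: h_def vec_bit_add_eq_0_iff)
  have zw: "z + w = h"
    using assms(2) by (simp add: h_def vec_bit_add_eq_0_iff)
  have F: "F z + F w = F x + F y"
    using assms(3) by (simp add: vec_bit_add_eq_0_iff)
  have shift: "x + h = y" "y + h = x" "z + h = w"
    by (metis h_def zw add.commute vec_bit_add_add_self)+
  let ?T = "{t. F (t + h) + F t = F x + F y}"
  have "card ?T \<le> 2"
    using assms(1) h by (auto simp: APN_def)
  moreover have "{x, y, z} \<subseteq> ?T"
    using F add.commute[of "F y" "F x"] add.commute[of "F w" "F z"] by (simp add: shift)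
  ultimately have "card {x, y, z} \<le> 2"
    by (meson card_mono finite order_trans)
  then have "z = x \<or> z = y"
    using False by (auto simp: card_insert_if split: if_splits)
  then show ?thesis
    using shift by auto
qed

text \<open>
  By the Sidon property only the three trivial families of quadruples occur, each of size $|A|^2$. They
  pairwise meet in the constant quadruples, so the diagonal is removed from two of them.
\<close>

lemma card_quadruples_le:
  assumes "APN F"
  shows "int (card (quadruples F A)) \<le> 3 * (int (card A))\<^sup>2 - 2 * int (card A)"
proof -
  define D where "D = (\<lambda>x. (x, x)) ` A"
  define E where "E = A \<times> A - D"
  have fin: "finite A" "finite (A \<times> A)" "finite E"
    by simp_all
  have cD: "card D = card A"
    unfolding D_def by (rule card_image) (simp add: inj_on_def)
  have "card E = card (A \<times> A) - card D"
    unfolding E_def by (rule card_Diff_subset) (auto simp: D_def)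
  moreover have "card D \<le> card (A \<times> A)"
    by (rule card_mono) (auto simp: D_def)
  ultimately have cE: "int (card E) = (int (card A))\<^sup>2 - int (card A)"
    by (simp add: cD card_cartesian_product power2_eq_square of_nat_diff)
  have "quadruples F A \<subseteq> (\<lambda>(x, z). ((x, x), (z, z))) ` (A \<times> A) \<union>
      ((\<lambda>(x, y). ((x, y), (x, y))) ` E \<union> (\<lambda>(x, y). ((x, y), (y, x))) ` E)"
    (is "_ \<subseteq> ?X \<union> (?Y \<union> ?Z)")
  proof
    fix p assume "p \<in> quadruples F A"
    then obtain x y z w where p: "p = ((x, y), (z, w))" "x \<in> A" "y \<in> A" "z \<in> A" "w \<in> A"
      and eq: "x + y + (z + w) = 0" "F x + F y + (F z + F w) = 0"
      by (auto simp: quadruples_def)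
    consider "x = y" "z = w" | "x \<noteq> y" "z = x" "w = y" | "x \<noteq> y" "w = x" "z = y"
      using APN_sidon[OF assms eq] by blast
    then show "p \<in> ?X \<union> (?Y \<union> ?Z)"
    proof cases
      case 1
      then have "p \<in> ?X"
        using p by auto
      then show ?thesis
        by blast
    next
      case 2
      then have "p \<in> ?Y"
        using p by (auto simp: E_def D_def)
      then show ?thesis
        by blast
    next
      case 3
      then have "p \<in> ?Z"
        using p by (auto simp: E_def D_def)
      then show ?thesis
        by blast
    qed
  qed
  then have "card (quadruples F A) \<le> card (?X \<union> (?Y \<union> ?Z))"
    by (rule card_mono[rotated]) simp
  also have "\<dots> \<le> card ?X + (card ?Y + card ?Z)"
    by (meson card_Un_le order_trans add_left_mono)
  also have "\<dots> \<le> card (A \<times> A) + (card E + card E)"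
    by (intro add_mono card_image_le fin)
  finally have "int (card (quadruples F A)) \<le> int (card (A \<times> A) + (card E + card E))"
    by linarith
  then show ?thesis
    by (simp add: cE card_cartesian_product power2_eq_square)
qed

lemma walsh_on_fourth_moment_le:
  fixes A :: "(bit ^ 'n) set"
  assumes "APN F"
  shows "(\<Sum>c\<in>UNIV. \<Sum>a\<in>UNIV. (walsh_on F A c a) ^ 4)
     \<le> (2 ^ CARD('n))\<^sup>2 * (3 * (int (card A))\<^sup>2 - 2 * int (card A))"
  unfolding walsh_on_fourth_moment using card_quadruples_le[OF assms] by (intro mult_left_mono) auto

text \<open>
  The Cauchy--Schwarz inequality between the second and fourth moments, with its defect kept: the
  inequality serves for small sets, the equality case for the whole space.
\<close>

lemma walsh_on_fourth_moment_excess: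
  fixes A :: "(bit ^ 'n) set"
  shows "(\<Sum>a\<in>UNIV. ((walsh_on F A c a)\<^sup>2 - int (card A))\<^sup>2)
    = (\<Sum>a\<in>UNIV. (walsh_on F A c a) ^ 4) - 2 ^ CARD('n) * (int (card A))\<^sup>2"
proof -
  have "((walsh_on F A c a)\<^sup>2 - int (card A))\<^sup>2
     = (walsh_on F A c a) ^ 4 - 2 * int (card A) * (walsh_on F A c a)\<^sup>2 + (int (card A))\<^sup>2" for a
    by (simp add: power2_eq_square power4_eq_xxxx algebra_simps)
  then have "(\<Sum>a\<in>UNIV. ((walsh_on F A c a)\<^sup>2 - int (card A))\<^sup>2)
    = (\<Sum>a\<in>UNIV. (walsh_on F A c a) ^ 4) - 2 * int (card A) * (\<Sum>a\<in>UNIV. (walsh_on F A c a)\<^sup>2)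
      + 2 ^ CARD('n) * (int (card A))\<^sup>2"
    using card_vec_bit[where 'n = 'n]
    by (simp add: sum.distrib sum_subtractf sum_distrib_left del: CARD_vec)
  then show ?thesis
    unfolding walsh_on_parseval by (simp add: power2_eq_square)
qed

section \<open>Plateaued functions in even dimension\<close>

text \<open>
  If $k$ values of the transform are nonzero, all of absolute value $L$, then Parseval reads
  $k L^2 = 2^{4m}$. So $L$ is a power of two, and $k \le 2^{2m}$ gives $L \ge 2^m$, with equality only if
  no value vanishes.
\<close>

lemma plateaued_amplitude:
  fixes f :: "bit ^ 'n \<Rightarrow> bit"
  assumes "plateaued f" and n: "CARD('n) = 2 * m"
  obtains j where "m \<le> j" "\<And>a. walsh f a = 0 \<or> \<bar>walsh f a\<bar> = 2 ^ j"
    "j = m \<Longrightarrow> \<forall>a. walsh f a \<noteq> 0"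
proof -
  obtain l :: real where l: "l > 0" "\<And>a. real_of_int (walsh f a) \<in> {0, l, - l}"
    using assms(1) by (auto simp: plateaued_def)
  obtain a0 where a0: "walsh f a0 \<noteq> 0"
  proof (rule ccontr)
    assume "\<not> thesis"
    then have "(\<Sum>a\<in>UNIV. (walsh f a)\<^sup>2) = 0"
      using that by (intro sum.neutral) auto
    then show False
      by (simp add: walsh_parseval)
  qed
  define L where "L = nat \<bar>walsh f a0\<bar>"
  have L: "int L = \<bar>walsh f a0\<bar>" "real L = l"
    using l a0 by (auto simp: L_def dest: spec[of _ a0])
      (use l(2)[of a0] a0 l(1) in auto)+
  have vals: "walsh f a = 0 \<or> \<bar>walsh f a\<bar> = int L" for a
    using l(2)[of a] l(1) L(2) by (auto simp: abs_if)
  let ?X = "{a. walsh f a \<noteq> 0}"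
  have "(\<Sum>a\<in>UNIV. (walsh f a)\<^sup>2) = (\<Sum>a\<in>?X. (int L)\<^sup>2)"
  proof (rule sum.mono_neutral_cong_right)
    fix a assume "a \<in> ?X"
    then have "\<bar>walsh f a\<bar> = int L"
      using vals by blast
    then show "(walsh f a)\<^sup>2 = (int L)\<^sup>2"
      by (metis power2_abs)
  qed auto
  then have "int (card ?X * L\<^sup>2) = int ((2 ^ CARD('n))\<^sup>2)"
    by (simp add: walsh_parseval)
  then have eq: "card ?X * L\<^sup>2 = 2 ^ (4 * m)"
    unfolding of_nat_eq_iff by (simp add: n flip: power_mult)
  then have "L dvd 2 ^ (4 * m)"
    by (metis dvd_mult dvd_triv_left power2_eq_square)
  then obtain j where j: "L = 2 ^ j"
    by (auto simp: divides_primepow_nat)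
  have cX: "card ?X \<le> 2 ^ (2 * m)"
    using card_mono[of "UNIV :: (bit ^ 'n) set" ?X] card_vec_bit[where 'n = 'n] by (simp add: n del: CARD_vec)
  have sq: "L\<^sup>2 = 2 ^ (2 * j)"
    by (simp add: j mult.commute flip: power_mult)
  have "(2::nat) ^ (4 * m) \<le> 2 ^ (2 * m) * 2 ^ (2 * j)"
    unfolding eq[symmetric] sq using cX by (rule mult_le_mono1)
  then have "(2::nat) ^ (4 * m) \<le> 2 ^ (2 * m + 2 * j)"
    by (simp only: power_add)
  then have "4 * m \<le> 2 * m + 2 * j"
    by (subst (asm) power_increasing_iff) auto
  then have "m \<le> j"
    by simp
  moreover have "\<forall>a. walsh f a \<noteq> 0" if "j = m"
  proof -
    have "card ?X * 2 ^ (2 * m) = 2 ^ (2 * m) * 2 ^ (2 * m)"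
      using eq[unfolded sq] that by (simp flip: power_add)
    then have "card ?X = CARD(bit ^ 'n)"
      using card_vec_bit[where 'n = 'n] by (simp add: n del: CARD_vec)
    then have "?X = UNIV"
      by (metis card_eq_UNIV_imp_eq_UNIV finite)
    then show ?thesis
      by blast
  qed
  ultimately show ?thesis
    using that[of j] vals j by auto
qed

text \<open>
  Either bent, or divisible by one more power of two; only this distinction matters for the divisibility of
  differences of two such transforms.
\<close>

lemma plateaued_dichotomy:
  fixes f :: "bit ^ 'n \<Rightarrow> bit"
  assumes "plateaued f" and n: "CARD('n) = 2 * m"
  shows "(\<forall>a. \<bar>walsh f a\<bar> = 2 ^ m) \<or> (\<forall>a. 2 ^ (m + 1) dvd walsh f a)"
proof -
  obtain j where j: "m \<le> j" "\<And>a. walsh f a = 0 \<or> \<bar>walsh f a\<bar> = 2 ^ j"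
    "j = m \<Longrightarrow> \<forall>a. walsh f a \<noteq> 0"
    using plateaued_amplitude[OF assms] by blast
  show ?thesis
  proof (cases "j = m")
    case True
    then show ?thesis
      using j by blast
  next
    case False
    then have dvd: "(2::int) ^ (m + 1) dvd 2 ^ j"
      using j(1) by (intro le_imp_power_dvd) auto
    have "2 ^ (m + 1) dvd walsh f a" for a
      using j(2)[of a] dvd by (metis dvd_0_right dvd_abs_iff)
    then show ?thesis
      by blast
  qed
qed

section \<open>The minority set of a component with a large Walsh value\<close>

definition minority :: "(bit ^ 'n \<Rightarrow> bit ^ 'n) \<Rightarrow> bit ^ 'n \<Rightarrow> bit ^ 'n \<Rightarrow> int \<Rightarrow> (bit ^ 'n) set" where
  "minority F b a e = {x. chi (scalar_product b (F x)) * chi (scalar_product a x) = - e}"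

text \<open>
  The factor $1 - e\,(-1)^{b \cdot F(x) + a \cdot x}$ is twice the indicator of the minority set.
\<close>

lemma walsh_diff_minority:
  fixes F :: "bit ^ 'n \<Rightarrow> bit ^ 'n"
  assumes e: "e = 1 \<or> e = -1"
  shows "walsh (component F c) u - e * walsh (component F (c + b)) (u + a)
    = 2 * walsh_on F (minority F b a e) c u"
proof -
  let ?t = "\<lambda>x. chi (scalar_product c (F x)) * chi (scalar_product u x)"
  let ?s = "\<lambda>x. chi (scalar_product b (F x)) * chi (scalar_product a x)"
  have s: "?s x = 1 \<or> ?s x = -1" for x
    using chi_cases[of "scalar_product b (F x)"] chi_cases[of "scalar_product a x"] by auto
  have "walsh (component F c) u - e * walsh (component F (c + b)) (u + a)
     = (\<Sum>x\<in>UNIV. ?t x - e * (?t x * ?s x))"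
    by (simp only: walsh_component walsh_on_def scalar_product_add_left chi_add sum_subtractf
        sum_distrib_left ac_simps)
  also have "\<dots> = (\<Sum>x\<in>UNIV. if x \<in> minority F b a e then 2 * ?t x else 0)"
  proof (rule sum.cong[OF refl])
    fix x
    show "?t x - e * (?t x * ?s x) = (if x \<in> minority F b a e then 2 * ?t x else 0)"
      using s[of x] e unfolding minority_def mem_Collect_eq by (elim disjE) (simp_all only:, auto)
  qed
  also have "\<dots> = (\<Sum>x\<in>minority F b a e. 2 * ?t x)"
    by (subst sum.inter_restrict[symmetric]) auto
  finally show ?thesis
    by (simp add: walsh_on_def sum_distrib_left mult.assoc)
qed

lemma walsh_on_0_0: "walsh_on F A 0 0 = int (card A)" for A :: "(bit ^ 'n) set"
  by (simp add: walsh_on_def)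

lemma walsh_on_minority: "walsh_on F (minority F b a e) b a = - e * int (card (minority F b a e))"
  by (simp add: walsh_on_def minority_def)

lemma walsh_eq_minority:
  fixes F :: "bit ^ 'n \<Rightarrow> bit ^ 'n"
  assumes e: "e = 1 \<or> e = -1"
  shows "e * walsh (component F b) a = 2 ^ CARD('n) - 2 * int (card (minority F b a e))"
  using walsh_diff_minority[OF e, of F 0 0 b a] card_vec_bit[where 'n = 'n]
  by (simp add: walsh_on_0_0 walsh_component del: CARD_vec)

text \<open>
  If both components are bent or neither is, half the difference of their transforms is a multiple of
  $2^m$. In the mixed case that difference is an odd multiple of $2^m$ at every frequency, hence nowhere
  small, and Parseval would make the minority set contain at least a quarter of the space.
\<close>

lemma minority_walsh_on_dvd:
  fixes F :: "bit ^ 'n \<Rightarrow> bit ^ 'n"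
  assumes n: "CARD('n) = 2 * m" and e: "e = 1 \<or> e = -1"
    and small: "4 * int (card (minority F b a e)) < 2 ^ CARD('n)"
    and pl: "plateaued (component F c)" "plateaued (component F (c + b))"
  shows "2 ^ m dvd walsh_on F (minority F b a e) c u"
proof -
  let ?S = "minority F b a e"
  let ?V = "\<lambda>u. walsh (component F c) u"
  let ?W = "\<lambda>u. e * walsh (component F (c + b)) (u + a)"
  have diff: "?V u - ?W u = 2 * walsh_on F ?S c u" for u
    by (rule walsh_diff_minority[OF e])
  have V: "(\<forall>u. \<bar>?V u\<bar> = 2 ^ m) \<or> (\<forall>u. 2 ^ (m + 1) dvd ?V u)"
    by (rule plateaued_dichotomy[OF pl(1) n])
  have "\<bar>?W u\<bar> = \<bar>walsh (component F (c + b)) (u + a)\<bar>" for u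
    using e by auto
  then have W: "(\<forall>u. \<bar>?W u\<bar> = 2 ^ m) \<or> (\<forall>u. 2 ^ (m + 1) dvd ?W u)"
    using plateaued_dichotomy[OF pl(2) n] by auto
  have bent: "(2::int) ^ m dvd x \<and> \<not> 2 ^ (m + 1) dvd x" if "\<bar>x\<bar> = 2 ^ m" for x :: int
  proof -
    have "x = 2 ^ m \<or> x = - (2 ^ m)"
      using that by linarith
    then show ?thesis
      by auto
  qed
  have half: "(2::int) ^ m dvd x" if "2 ^ (m + 1) dvd x" for x
    using that by (auto elim: dvd_mult_left)
  show ?thesis
  proof (cases "(\<forall>u. \<bar>?V u\<bar> = 2 ^ m) \<longleftrightarrow> (\<forall>u. \<bar>?W u\<bar> = 2 ^ m)")
    case True
    then consider "\<bar>?V u\<bar> = 2 ^ m" "\<bar>?W u\<bar> = 2 ^ m" | "2 ^ (m + 1) dvd ?V u" "2 ^ (m + 1) dvd ?W u"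
      using V W by blast
    then have "2 * 2 ^ m dvd ?V u - ?W u"
    proof cases
      case 1
      then have "?V u - ?W u = 0 \<or> ?V u - ?W u = 2 * 2 ^ m \<or> ?V u - ?W u = - (2 * 2 ^ m)"
        by linarith
      then show ?thesis
        by auto
    next
      case 2
      then show ?thesis
        using dvd_diff by (metis add.commute plus_1_eq_Suc power_Suc)
    qed
    then show ?thesis
      unfolding diff by simp
  next
    case False
    have "(2 ^ m)\<^sup>2 \<le> (2 * walsh_on F ?S c u)\<^sup>2" for u
    proof -
      have "\<bar>?V u\<bar> = 2 ^ m \<and> 2 ^ (m + 1) dvd ?W u \<or> 2 ^ (m + 1) dvd ?V u \<and> \<bar>?W u\<bar> = 2 ^ m"
        using False V W by blast
      then have "2 ^ m dvd ?V u - ?W u \<and> \<not> 2 ^ (m + 1) dvd ?V u - ?W u"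
      proof (elim disjE conjE)
        assume "\<bar>?V u\<bar> = 2 ^ m" "2 ^ (m + 1) dvd ?W u"
        then show ?thesis
          using bent[of "?V u"] half[of "?W u"] by (meson dvd_diff dvd_diff_left_iff)
      next
        assume "2 ^ (m + 1) dvd ?V u" "\<bar>?W u\<bar> = 2 ^ m"
        then show ?thesis
          using bent[of "?W u"] half[of "?V u"] by (meson dvd_diff dvd_diff_right_iff)
      qed
      then have "2 ^ m dvd 2 * walsh_on F ?S c u" "2 * walsh_on F ?S c u \<noteq> 0"
        unfolding diff by auto
      then have "2 ^ m \<le> \<bar>2 * walsh_on F ?S c u\<bar>"
        using dvd_imp_le_int[of "2 * walsh_on F ?S c u" "2 ^ m"] by simp
      then have "(2 ^ m)\<^sup>2 \<le> \<bar>2 * walsh_on F ?S c u\<bar>\<^sup>2"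
        by (intro power_mono) auto
      then show ?thesis
        by simp
    qed
    then have "(\<Sum>u\<in>(UNIV :: (bit ^ 'n) set). (2 ^ m)\<^sup>2) \<le> (\<Sum>u\<in>UNIV. (2 * walsh_on F ?S c u)\<^sup>2)"
      by (rule sum_mono)
    also have "\<dots> = 4 * (\<Sum>u\<in>UNIV. (walsh_on F ?S c u)\<^sup>2)"
      by (simp add: power_mult_distrib sum_distrib_left)
    also have "\<dots> = 2 ^ CARD('n) * (4 * int (card ?S))"
      by (simp add: walsh_on_parseval)
    also have "\<dots> < 2 ^ CARD('n) * 2 ^ CARD('n)"
      using small by (intro mult_strict_left_mono) auto
    finally have "(\<Sum>u\<in>(UNIV :: (bit ^ 'n) set). ((2::int) ^ m)\<^sup>2) < 2 ^ CARD('n) * 2 ^ CARD('n)" .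
    moreover have "((2::int) ^ m)\<^sup>2 = 2 ^ CARD('n)"
      by (simp add: n mult.commute flip: power_mult)
    ultimately have False
      using card_vec_bit[where 'n = 'n] by (simp del: CARD_vec)
    then show ?thesis ..
  qed
qed

lemma walsh_on_fourth_moment_ge:
  fixes A :: "(bit ^ 'n) set"
  shows "2 ^ CARD('n) * (int (card A))\<^sup>2 \<le> (\<Sum>a\<in>UNIV. (walsh_on F A c a) ^ 4)"
proof -
  have "0 \<le> (\<Sum>a\<in>UNIV. ((walsh_on F A c a)\<^sup>2 - int (card A))\<^sup>2)"
    by (intro sum_nonneg) simp
  then show ?thesis
    unfolding walsh_on_fourth_moment_excess by simp
qed

text \<open>
  A multiple of $2^m$ satisfies $t^4 \ge 2^{2m} t^2$. For sets smaller than $2^{2m}$ this beats the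
  Cauchy--Schwarz bound.
\<close>

lemma walsh_on_fourth_moment_ge_dvd:
  fixes A :: "(bit ^ 'n) set"
  assumes n: "CARD('n) = 2 * m" and dvd: "\<And>a. 2 ^ m dvd walsh_on F A c a"
  shows "(2 ^ CARD('n))\<^sup>2 * int (card A) \<le> (\<Sum>a\<in>UNIV. (walsh_on F A c a) ^ 4)"
proof -
  have N: "((2::int) ^ m)\<^sup>2 = 2 ^ CARD('n)"
    by (simp add: n mult.commute flip: power_mult)
  have "2 ^ CARD('n) * (walsh_on F A c a)\<^sup>2 \<le> (walsh_on F A c a) ^ 4" for a
  proof (cases "walsh_on F A c a = 0")
    case False
    then have "2 ^ m \<le> \<bar>walsh_on F A c a\<bar>"
      using dvd_imp_le_int[of "walsh_on F A c a" "2 ^ m"] dvd[of a] by simp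
    then have "(2 ^ m)\<^sup>2 \<le> \<bar>walsh_on F A c a\<bar>\<^sup>2"
      by (intro power_mono) auto
    then have "2 ^ CARD('n) \<le> (walsh_on F A c a)\<^sup>2"
      by (simp add: N)
    then have "2 ^ CARD('n) * (walsh_on F A c a)\<^sup>2 \<le> (walsh_on F A c a)\<^sup>2 * (walsh_on F A c a)\<^sup>2"
      by (intro mult_right_mono) auto
    then show ?thesis
      by (simp add: power2_eq_square power4_eq_xxxx mult.assoc)
  qed simp
  then have "(\<Sum>a\<in>UNIV. 2 ^ CARD('n) * (walsh_on F A c a)\<^sup>2) \<le> (\<Sum>a\<in>UNIV. (walsh_on F A c a) ^ 4)"
    by (rule sum_mono)
  then show ?thesis
    unfolding sum_distrib_left[symmetric] walsh_on_parseval by (simp add: power2_eq_square mult.assoc)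
qed

lemma walsh_on_power4_le:
  fixes A :: "(bit ^ 'n) set"
  shows "(walsh_on F A c u) ^ 4 \<le> (\<Sum>a\<in>UNIV. (walsh_on F A c a) ^ 4)"
  by (rule member_le_sum) auto

section \<open>No affine components\<close>

text \<open>
  An affine component uses up all the excess that the fourth moment of an APN function allows, so every
  component outside $\{0, b\}$ is bent. Let $V$ be a coordinate hyperplane that does not contain $b$. The
  sum over $c \in V$ of the transforms at $0$ counts preimages under $F$ and is a multiple of $N/2$, but
  it is also $N$ plus an odd number of terms $\pm 2^m$. As $N/2 = 2^{2m-1}$, this is impossible for
  $m \ge 2$.
\<close>

lemma no_affine_component:
  fixes F :: "bit ^ 'n \<Rightarrow> bit ^ 'n"
  assumes apn: "APN F" and n: "CARD('n) = 2 * m" and m: "m \<ge> 2" and b: "b \<noteq> 0"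
  shows "\<bar>walsh (component F b) a0\<bar> \<noteq> 2 ^ CARD('n)"
proof
  assume aff: "\<bar>walsh (component F b) a0\<bar> = 2 ^ CARD('n)"
  define N :: int where "N = 2 ^ CARD('n)"
  define M where "M = (\<lambda>c. \<Sum>a\<in>UNIV. (walsh_on F UNIV c a) ^ 4)"
  define E where "E = (\<lambda>c. \<Sum>a\<in>UNIV. ((walsh_on F UNIV c a)\<^sup>2 - N)\<^sup>2)"
  have cN: "int (CARD(bit ^ 'n)) = N"
    using card_vec_bit[where 'n = 'n] by (simp add: N_def del: CARD_vec)
  have E: "E c = M c - N * N\<^sup>2" for c
    using walsh_on_fourth_moment_excess[of F UNIV c] unfolding E_def M_def cN N_def[symmetric] .
  have "N ^ 4 \<le> M 0"
    using walsh_on_power4_le[of F UNIV 0 0] unfolding M_def walsh_on_0_0 cN .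
  moreover have "N ^ 4 \<le> M b"
  proof -
    have "N ^ 4 = \<bar>walsh_on F UNIV b a0\<bar> ^ 4"
      using aff by (simp add: N_def walsh_component)
    then show ?thesis
      using walsh_on_power4_le[of F UNIV b a0] by (simp add: M_def power_even_abs)
  qed
  moreover have "(\<Sum>c\<in>UNIV. M c) \<le> N\<^sup>2 * (3 * N\<^sup>2 - 2 * N)"
    using walsh_on_fourth_moment_le[OF apn, of UNIV] unfolding M_def cN N_def[symmetric] .
  moreover have "(\<Sum>c\<in>UNIV. M c) = M 0 + M b + (\<Sum>c\<in>UNIV - {0, b}. M c)"
    using sum.subset_diff[of "{0, b}" UNIV M] b by simp
  moreover have "(\<Sum>c\<in>UNIV - {0, b}. M c) = (\<Sum>c\<in>UNIV - {0, b}. E c) + (N - 2) * (N * N\<^sup>2)"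
  proof -
    have "int (card (UNIV - {0, b})) = N - 2"
      using b cN card_Diff_subset[of "{0, b}" UNIV] card_mono[of UNIV "{0, b}"]
      by (simp add: of_nat_diff del: CARD_vec)
    then show ?thesis
      by (simp add: E sum_subtractf)
  qed
  ultimately have "2 * N ^ 4 + (\<Sum>c\<in>UNIV - {0, b}. E c) + (N - 2) * (N * N\<^sup>2) \<le> N\<^sup>2 * (3 * N\<^sup>2 - 2 * N)"
    by linarith
  moreover have "2 * N ^ 4 + (N - 2) * (N * N\<^sup>2) = N\<^sup>2 * (3 * N\<^sup>2 - 2 * N)"
    by (simp add: power2_eq_square power4_eq_xxxx algebra_simps)
  ultimately have "(\<Sum>c\<in>UNIV - {0, b}. E c) \<le> 0"
    by linarith
  moreover have E0: "0 \<le> E c" for c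
    by (simp add: E_def sum_nonneg)
  ultimately have "(\<Sum>c\<in>UNIV - {0, b}. E c) = 0"
    by (meson order_antisym sum_nonneg)
  then have "E c = 0" if "c \<noteq> 0" "c \<noteq> b" for c
    using sum_nonneg_eq_0_iff[of "UNIV - {0, b}" E] E0 that by auto
  then have sq: "(walsh_on F UNIV c a)\<^sup>2 = N" if "c \<noteq> 0" "c \<noteq> b" for c a
    using that sum_nonneg_eq_0_iff[of UNIV "\<lambda>a. ((walsh_on F UNIV c a)\<^sup>2 - N)\<^sup>2"] by (auto simp: E_def)
  have NN: "((2::int) ^ m)\<^sup>2 = N"
    by (simp add: N_def n mult.commute flip: power_mult)
  obtain i where i: "b $ i = 1"
    using b by (metis bit_not_zero_iff vec_eq_iff zero_index)
  define V where "V = {c :: bit ^ 'n. c $ i = 0}"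
  \<comment> \<open>Averaging over the characters trivial on \<open>V\<close> turns sums over \<open>V\<close> into sums over the whole space,
    where orthogonality applies.\<close>
  have chi_i: "1 + chi (scalar_product c (axis i 1)) = (if c \<in> V then 2 else 0)" for c
    by (cases "c $ i") (auto simp: scalar_product_axis V_def)
  have cardV: "2 * int (card V) = N"
  proof -
    have "(\<Sum>c\<in>UNIV. 1 + chi (scalar_product c (axis i 1))) = N"
      by (simp add: sum.distrib sum_chi cN del: CARD_vec)
    moreover have "(\<Sum>c\<in>UNIV. if c \<in> V then 2 else 0) = 2 * int (card V)"
      by (subst sum.inter_restrict[symmetric]) auto
    ultimately show ?thesis
      unfolding chi_i by simp
  qed
  have "\<exists>k. 2 * (\<Sum>c\<in>V. walsh_on F UNIV c 0) = N * k"
  proof -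
    have "2 * (\<Sum>c\<in>V. walsh_on F UNIV c 0) = (\<Sum>c\<in>UNIV. if c \<in> V then 2 * walsh_on F UNIV c 0 else 0)"
      by (subst sum.inter_restrict[symmetric]) (auto simp: sum_distrib_left)
    also have "\<dots> = (\<Sum>c\<in>UNIV. walsh_on F UNIV c 0 * (1 + chi (scalar_product c (axis i 1))))"
      unfolding chi_i by (rule sum.cong) auto
    also have "\<dots> = (\<Sum>c\<in>UNIV. \<Sum>x\<in>UNIV. chi (scalar_product c (F x)) + chi (scalar_product c (F x + axis i 1)))"
      by (simp add: walsh_on_def scalar_product_add_right chi_add sum.distrib sum_distrib_right distrib_left del: add_bit_eq_xor)
    also have "\<dots> = (\<Sum>x\<in>UNIV. (\<Sum>c\<in>UNIV. chi (scalar_product c (F x))) + (\<Sum>c\<in>UNIV. chi (scalar_product c (F x + axis i 1))))"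
      by (subst sum.swap) (simp add: sum.distrib)
    also have "\<dots> = N * (\<Sum>x\<in>UNIV. of_bool (F x = 0) + of_bool (F x + axis i 1 = 0))"
      unfolding sum_chi N_def by (simp add: sum_distrib_left distrib_left mult.commute)
    finally show ?thesis
      by blast
  qed
  then obtain k where k: "2 * (\<Sum>c\<in>V. walsh_on F UNIV c 0) = N * k" ..
  have "\<exists>r. odd r \<and> (\<Sum>c\<in>V - {0}. walsh_on F UNIV c 0) = 2 ^ m * r"
  proof -
    have "\<exists>r. odd r \<and> walsh_on F UNIV c 0 = 2 ^ m * r" if "c \<in> V - {0}" for c
    proof -
      have "c \<noteq> 0" "c \<noteq> b"
        using that i by (auto simp: V_def)
      then have "(walsh_on F UNIV c 0)\<^sup>2 = (2 ^ m)\<^sup>2"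
        using sq NN by simp
      then have "walsh_on F UNIV c 0 = 2 ^ m * 1 \<or> walsh_on F UNIV c 0 = 2 ^ m * (-1)"
        by (simp add: power2_eq_iff)
      then show ?thesis
        by (metis odd_one even_minus)
    qed
    then obtain r where r: "\<And>c. c \<in> V - {0} \<Longrightarrow> odd (r c) \<and> walsh_on F UNIV c 0 = 2 ^ m * r c"
      by metis
    have "0 \<in> V"
      by (simp add: V_def)
    then have "int (card (V - {0})) = int (card V) - 1"
      using card.remove[of V 0] by simp
    moreover have "even (int (card V))"
    proof -
      have "2 * int (card V) = 2 * (2 * 2 ^ (2 * m - 2))"
        unfolding cardV N_def n using m by (simp flip: power_Suc)
      then show ?thesis
        by simp
    qed
    ultimately have "odd (int (card (V - {0})))"
      by presburger
    then have "odd (card (V - {0}))"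
      by simp
    then have "odd (\<Sum>c\<in>V - {0}. r c)"
    proof -
      have "{c \<in> V - {0}. odd (r c)} = V - {0}"
        using r by blast
      with \<open>odd (card (V - {0}))\<close> show ?thesis
        by (simp add: even_sum_iff)
    qed
    moreover have "(\<Sum>c\<in>V - {0}. walsh_on F UNIV c 0) = 2 ^ m * (\<Sum>c\<in>V - {0}. r c)"
      using r by (simp add: sum_distrib_left)
    ultimately show ?thesis
      by blast
  qed
  then obtain r where r: "odd r" "(\<Sum>c\<in>V - {0}. walsh_on F UNIV c 0) = 2 ^ m * r"
    by blast
  have "(\<Sum>c\<in>V. walsh_on F UNIV c 0) = N + 2 ^ m * r"
    using sum.remove[of V 0 "\<lambda>c. walsh_on F UNIV c 0"] r(2) by (simp add: V_def walsh_on_0_0 cN del: CARD_vec)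
  then have "2 * (2 ^ m * 2 ^ m + 2 ^ m * r) = 2 ^ m * 2 ^ m * k"
    using k NN by (simp add: power2_eq_square)
  then have "2 ^ m * (2 * 2 ^ m + 2 * r) = 2 ^ m * (2 ^ m * k)"
    by (simp add: algebra_simps)
  then have "2 * 2 ^ m + 2 * r = 2 ^ m * k"
    by (subst (asm) mult_cancel_left) simp
  moreover have "(2::int) ^ m = 4 * 2 ^ (m - 2)"
    using power_add[of "2::int" 2 "m - 2"] unfolding le_add_diff_inverse[OF m] by simp
  ultimately have "r = 2 * (2 ^ (m - 2) * k - 2 * 2 ^ (m - 2))"
    by simp
  then show False
    using r(1) by simp
qed

section \<open>Counting components that are not plateaued\<close>

text \<open>No power of two lies strictly between $N/2$ and $N$.\<close>

lemma nonplateaued_if_large_walsh: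
  fixes F :: "bit ^ 'n \<Rightarrow> bit ^ 'n"
  assumes n: "CARD('n) = 2 * m"
    and large: "2 ^ CARD('n) < 2 * \<bar>walsh (component F b) a\<bar>" "\<bar>walsh (component F b) a\<bar> < 2 ^ CARD('n)"
  shows "\<not> plateaued (component F b)"
proof
  assume "plateaued (component F b)"
  then obtain j where "walsh (component F b) a = 0 \<or> \<bar>walsh (component F b) a\<bar> = 2 ^ j"
    using plateaued_amplitude[OF _ n] by metis
  then have j: "\<bar>walsh (component F b) a\<bar> = 2 ^ j"
    using large(1) by (cases "walsh (component F b) a = 0") auto
  have "(2::int) ^ CARD('n) < 2 ^ Suc j" "(2::int) ^ j < 2 ^ CARD('n)"
    using large j by simp_all
  then have "CARD('n) < Suc j" "j < CARD('n)"
    by (meson one_less_numeral_iff power_less_imp_less_exp semiring_norm(76))+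
  then show False
    by simp
qed

text \<open>
  The fourth-moment comparison, with \<open>g\<close> indices whose pair is plateaued and \<open>b\<close> others. After
  eliminating \<open>g\<close> the inequality factors, leaving $b N \ge N^2 - 2 s N - 2 s^2$. The right-hand side
  decreases in $s$; at $s = N/4 - 1$ it equals $3N^2/8 + 3N - 2$. Using $s \le N/4 - 1$ rather than
  $s < N/4$ is what produces the additive constant of the theorem.
\<close>

lemma bad_count_arith:
  fixes N s g b :: int
  assumes s: "0 < s" "4 * s \<le> N - 4" and gb: "g + b = N - 2" and b: "0 \<le> b"
    and le: "2 * s ^ 4 + g * (N\<^sup>2 * s) + b * (N * s\<^sup>2) \<le> N\<^sup>2 * (3 * s\<^sup>2 - 2 * s)"
  shows "3 * N + 16 < 8 * b"
proof -
  have g: "g = N - 2 - b"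
    using gb by simp
  have "N\<^sup>2 * (3 * s\<^sup>2 - 2 * s) - (2 * s ^ 4 + g * (N\<^sup>2 * s) + b * (N * s\<^sup>2))
    = s * ((N - s) * (b * N - (N\<^sup>2 - 2 * s * N - 2 * s\<^sup>2)))"
    unfolding g by (simp add: power2_eq_square power4_eq_xxxx algebra_simps)
  then have "0 \<le> s * ((N - s) * (b * N - (N\<^sup>2 - 2 * s * N - 2 * s\<^sup>2)))"
    using le by linarith
  then have "N\<^sup>2 - 2 * s * N - 2 * s\<^sup>2 \<le> b * N"
    using s by (simp add: zero_le_mult_iff)
  moreover have "(4 * s) * (4 * s) \<le> (N - 4) * (N - 4)" "(4 * s) * N \<le> (N - 4) * N"
    using s by (intro mult_mono mult_right_mono; simp)+
  ultimately have "(3 * N + 16) * N < (8 * b) * N"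
    using s by (simp add: power2_eq_square algebra_simps)
  then show ?thesis
    using s by (simp add: mult_less_cancel_right)
qed

text \<open>
  Adding $b$ permutes the indices outside $\{0, b\}$, so each component there that is not plateaued spoils
  at most two of them: itself and its partner.
\<close>

lemma many_nonplateaued:
  fixes F :: "bit ^ 'n \<Rightarrow> bit ^ 'n"
  assumes apn: "APN F" and n: "CARD('n) = 2 * m" and m: "m \<ge> 2" and b: "b \<noteq> 0"
    and large: "2 ^ CARD('n) < 2 * \<bar>walsh (component F b) a0\<bar>"
  shows "3 * 2 ^ CARD('n) + 32 < 16 * int (card {c. c \<noteq> 0 \<and> \<not> plateaued (component F c)})"
proof -
  define N :: int where "N = 2 ^ CARD('n)"
  define e :: int where "e = (if walsh (component F b) a0 \<ge> 0 then 1 else -1)"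
  define S where "S = minority F b a0 e"
  define s where "s = int (card S)"
  define Q where "Q = {c. c \<noteq> 0 \<and> \<not> plateaued (component F c)}"
  define M where "M = (\<lambda>c. \<Sum>a\<in>UNIV. (walsh_on F S c a) ^ 4)"
  have cN: "int (CARD(bit ^ 'n)) = N"
    using card_vec_bit[where 'n = 'n] by (simp add: N_def del: CARD_vec)
  have e: "e = 1 \<or> e = -1"
    by (simp add: e_def)
  have "e * walsh (component F b) a0 = N - 2 * s"
    unfolding N_def s_def S_def by (rule walsh_eq_minority[OF e])
  then have W: "\<bar>walsh (component F b) a0\<bar> = N - 2 * s"
    by (simp add: e_def split: if_splits)
  have s_small: "4 * s < N"
    using large W by (simp add: N_def)
  have "s \<noteq> 0"
    using no_affine_component[OF apn n m b, of a0] W by (simp add: N_def)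
  then have s_pos: "0 < s"
    by (simp add: s_def card_gt_0_iff)
  \<comment> \<open>\<open>N\<close> is divisible by 4, so the strict bound on \<open>4 * s\<close> improves by 4.\<close>
  have "N = 4 * 2 ^ (2 * m - 2)"
  proof -
    have "CARD('n) = Suc (Suc (2 * m - 2))"
      using n m by simp
    then show ?thesis
      unfolding N_def by simp
  qed
  with s_small have s_le: "4 * s \<le> N - 4"
    by simp
  have bQ: "b \<in> Q"
    using nonplateaued_if_large_walsh[OF n large] b W s_pos by (simp add: Q_def N_def)
  define R where "R = UNIV - {0, b}"
  define G where "G = {c \<in> R. plateaued (component F c) \<and> plateaued (component F (c + b))}"
  define B where "B = R - G"
  have cR: "int (card R) = N - 2"
    using b cN card_Diff_subset[of "{0, b}" UNIV] card_mono[of UNIV "{0, b}"]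
    by (simp add: R_def of_nat_diff del: CARD_vec)
  have RGB: "R = G \<union> B" "G \<inter> B = {}"
    by (auto simp: B_def G_def)
  have cGB: "int (card G) + int (card B) = N - 2"
    using cR RGB card_Un_disjoint[of G B] by simp
  have "B \<subseteq> (Q - {b}) \<union> (\<lambda>c. c + b) ` (Q - {b})"
  proof
    fix c assume "c \<in> B"
    then have c: "c \<noteq> 0" "c \<noteq> b" and np: "\<not> plateaued (component F c) \<or> \<not> plateaued (component F (c + b))"
      by (auto simp: B_def G_def R_def)
    show "c \<in> (Q - {b}) \<union> (\<lambda>c. c + b) ` (Q - {b})"
    proof (cases "plateaued (component F c)")
      case True
      then have "c + b \<in> Q - {b}"
        using c np by (simp add: Q_def vec_bit_add_eq_0_iff)
      then have "c + b + b \<in> (\<lambda>c. c + b) ` (Q - {b})"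
        by (rule imageI)
      then show ?thesis
        by simp
    next
      case False
      then show ?thesis
        using c by (simp add: Q_def)
    qed
  qed
  then have "card B \<le> card ((Q - {b}) \<union> (\<lambda>c. c + b) ` (Q - {b}))"
    by (rule card_mono[rotated]) simp
  also have "\<dots> \<le> card (Q - {b}) + card (Q - {b})"
    by (meson card_Un_le card_image_le finite add_left_mono order_trans)
  finally have "card B \<le> 2 * card (Q - {b})"
    by simp
  then have "int (card B) \<le> 2 * int (card (Q - {b}))"
    by simp
  moreover have "int (card Q) = int (card (Q - {b})) + 1"
    using card.remove[OF finite bQ] by simp
  ultimately have cB: "int (card B) \<le> 2 * (int (card Q) - 1)"
    by simp
  have M0: "s ^ 4 \<le> M 0"
    using walsh_on_power4_le[of F S 0 0] unfolding M_def walsh_on_0_0 s_def .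
  have Mb: "s ^ 4 \<le> M b"
    using walsh_on_power4_le[of F S b a0] e by (auto simp: M_def s_def S_def walsh_on_minority)
  have MG: "N\<^sup>2 * s \<le> M c" if "c \<in> G" for c
    unfolding M_def N_def s_def
  proof (rule walsh_on_fourth_moment_ge_dvd[OF n])
    fix a
    show "2 ^ m dvd walsh_on F S c a"
      unfolding S_def by (rule minority_walsh_on_dvd[OF n e])
        (use that s_small in \<open>simp_all add: G_def s_def S_def N_def\<close>)
  qed
  have MB: "N * s\<^sup>2 \<le> M c" for c
    unfolding M_def N_def s_def by (rule walsh_on_fourth_moment_ge)
  have "2 * s ^ 4 + int (card G) * (N\<^sup>2 * s) + int (card B) * (N * s\<^sup>2)
      = s ^ 4 + s ^ 4 + ((\<Sum>c\<in>G. N\<^sup>2 * s) + (\<Sum>c\<in>B. N * s\<^sup>2))"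
    by simp
  also have "\<dots> \<le> M 0 + M b + ((\<Sum>c\<in>G. M c) + (\<Sum>c\<in>B. M c))"
    by (intro add_mono M0 Mb sum_mono MG MB)
  also have "\<dots> = (\<Sum>c\<in>UNIV. M c)"
    using sum.subset_diff[of "{0, b}" UNIV M] sum.union_disjoint[of G B M] b RGB
    by (simp add: R_def)
  also have "\<dots> \<le> N\<^sup>2 * (3 * s\<^sup>2 - 2 * s)"
    unfolding M_def N_def s_def by (rule walsh_on_fourth_moment_le[OF apn])
  finally have "3 * N + 16 < 8 * int (card B)"
    using bad_count_arith[OF s_pos s_le cGB] by simp
  then have "3 * N + 32 < 16 * int (card Q)"
    using cB by simp
  then show ?thesis
    unfolding N_def Q_def .
qed

theorem mainTheorem5:
  fixes F :: "bit ^ 'n \<Rightarrow> bit ^ 'n" and N q :: nat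
  assumes "CARD('n) \<ge> 4" and "even CARD('n)"
    and "N = 2 ^ CARD('n)"
    and "APN F"
    and "q = card {b. b \<noteq> 0 \<and> \<not> plateaued (component F b)}"
  shows "real q \<le> 3 * real N / 16 + 2 \<longrightarrow> real_of_int (linearity F) \<le> real N / 2"
proof (rule impI, rule ccontr)
  assume q: "real q \<le> 3 * real N / 16 + 2" and large: "\<not> real_of_int (linearity F) \<le> real N / 2"
  obtain m where n: "CARD('n) = 2 * m"
    using assms(2) by blast
  then have m: "m \<ge> 2"
    using assms(1) by simp
  let ?X = "{\<bar>walsh (component F b) a\<bar> | a b. b \<noteq> 0}"
  have "?X = (\<lambda>(a, b). \<bar>walsh (component F b) a\<bar>) ` (UNIV \<times> - {0})"
    by auto
  moreover have "axis undefined 1 \<in> - {0 :: bit ^ 'n}"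
    by simp
  ultimately have "finite ?X" "?X \<noteq> {}"
    by (simp, blast)
  then have "linearity F \<in> ?X"
    unfolding linearity_def by (rule Max_in)
  then obtain a b where b: "b \<noteq> 0" and lin: "linearity F = \<bar>walsh (component F b) a\<bar>"
    by blast
  have "real N < real_of_int (2 * \<bar>walsh (component F b) a\<bar>)"
    using large lin by simp
  then have "2 ^ CARD('n) < 2 * \<bar>walsh (component F b) a\<bar>"
    unfolding assms(3) by (metis of_int_less_iff of_int_of_nat_eq of_nat_numeral of_nat_power)
  from many_nonplateaued[OF assms(4) n m b this] have "int (3 * N + 32) < int (16 * q)"
    by (simp add: assms(3,5))
  then have "3 * N + 32 < 16 * q"
    by (simp only: of_nat_less_iff)
  then have "real (3 * N + 32) < real (16 * q)"
    by (simp only: of_nat_less_iff)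
  then show False
    using q by simp
qed

end
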